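(* Let $f:\mathcal H\to\mathbb R$ be continuously differentiable, $\mu$-strongly convex and $L$-smooth with $\mu,L>0$, and let $x^*$ be its unique minimizer. Suppose the non-negative perturbation parameters $\Delta_1,\Delta_2$ and the step size $s>0$ satisfy: (1) $\Delta_2\sqrt{s}\le\frac1L$; (2) $\Delta_2\le\sqrt{s}(1+\Delta_1)$; (3) $$\frac{\sqrt{\mu s}}{1+\sqrt{\mu s}}\Delta_2^2-\Delta_2\sqrt{s}(1+\Delta_1)\Big(\frac{\sqrt{\mu s}}{1+\sqrt{\mu s}}+2\Big)+(1+\Delta_1)^2s-\frac{\sqrt{\mu s}}{1+\sqrt{\mu s}}\frac{\Delta_1}{L}+\frac{2\mu\sqrt{s}}{(1+\sqrt{\mu s})L}\big(\Delta_2-\sqrt{s}(1+\Delta_1)\big)\le0 .$$ Then for any initial $x_0,v_0\in\mathcal H$, the sequence $\{x_k\}$ generated by $$\frac{x_{k+1}-x_k}{\sqrt{s}}=v_k,\qquad \frac{v_{k+1}-v_k}{\sqrt{s}}=-2\sqrt{\mu}\,v_{k+1}-(1+\Delta_1)\nabla f(x_{k+1})-\Delta_2\frac{\nabla f(x_{k+1})-\nabla f(x_k)}{\sqrt{s}}\qquad(k\ge0)$$ satisfies, for all $k\ge0$, $$f(x_k)-f(x^* )-\frac{\Delta_2\sqrt{s}}{2}\|\nabla f(x_k)\|^2\le\frac{1}{1+\Delta_1}\Big(1+\frac{\sqrt{\mu s}}{1+\sqrt{\mu s}}\Big)^{-k}E(0),$$ where $$E(0)=(1+\Delta_1)\Big(f(x_0)-f(x^*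 )-\frac{\Delta_2\sqrt{s}}{2}\|\nabla f(x_0)\|^2\Big)+\frac12\|v_0+\sqrt{\mu}(x_1-x^* )+\Delta_2\nabla f(x_0)\|^2 .$$ Thus, if in addition $\Delta_2\sqrt{s}<1/L$, then for all $k\ge0$, $$f(x_k)-f(x^* )\le\frac{1}{(1-L\Delta_2\sqrt{s})(1+\Delta_1)}\Big(1+\frac{\sqrt{\mu s}}{1+\sqrt{\mu s}}\Big)^{-k}E(0).$$
   Context: $\mathcal H$ is a real finite-dimensional Hilbert space with inner product $\langle\cdot,\cdot\rangle$ and induced norm $\|\cdot\|$. A continuously differentiable $f$ is $\mu$-strongly convex if $f(y)-f(x)\ge\langle\nabla f(x),y-x\rangle+\frac{\mu}{2}\|y-x\|^2$ for all $x,y\in\mathcal H$, and $L$-smooth if $\|\nabla f(x)-\nabla f(y)\|\le L\|x-y\|$ for all $x,y\in\mathcal H$. The scheme (symplectic Euler discretization) is equivalently $x_1=x_0+\sqrt s\,v_0$ and, for $k\ge1$, $x_{k+1}=x_k+\frac{1}{1+2\sqrt{\mu s}}(x_k-x_{k-1})-\frac{1+\Delta_1}{1+2\sqrt{\mu s}}s\nabla f(x_k)-\frac{\Delta_2\sqrt{s}}{1+2\sqrt{\mu s}}(\nabla f(x_k)-\nabla f(x_{k-1}))$. *)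

theory Defs
  imports "HOL-Analysis.Analysis"
begin

definition grad :: "('a::euclidean_space \<Rightarrow> real) \<Rightarrow> 'a \<Rightarrow> 'a" where
  "grad f x = (THE D. GDERIV f x :> D)"

lemma grad_eqI:
  assumes "GDERIV f x :> D"
  shows "grad f x = D"
  unfolding grad_def
proof (rule the_equality)
  fix D' assume "GDERIV f x :> D'"
  then have "(\<lambda>h. inner h D') = (\<lambda>h. inner h D)"
    using assms unfolding gderiv_def by (rule has_derivative_unique)
  then have "inner h D' = inner h D" for h
    by meson
  then show "D' = D"
    by (metis inner_commute vector_eq_rdot)
qed (fact assms)

lemma GDERIV_grad:
  assumes "f differentiable at x"
  shows "GDERIV f x :> grad f x"
proof -
  obtain A where A: "(f has_derivative A) (at x)"
    using assms by (auto simp: differentiable_def)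
  interpret A: bounded_linear A
    using A by (rule has_derivative_bounded_linear)
  have "A h = inner h (adjoint A 1)" for h
    using adjoint_works[OF A.linear, of h 1] by (simp add: inner_commute)
  then have "A = (\<lambda>h. inner h (adjoint A 1))"
    by (rule ext)
  with A have "GDERIV f x :> adjoint A 1"
    unfolding gderiv_def by simp
  then show ?thesis
    by (simp add: grad_eqI)
qed

definition continuously_differentiable :: "('a::euclidean_space \<Rightarrow> real) \<Rightarrow> bool" where
  "continuously_differentiable f \<longleftrightarrow>
     (\<forall>x. f differentiable at x) \<and> continuous_on UNIV (grad f)"

text \<open>The next two notions are meant for continuously differentiable functions only:
  where \<open>f\<close> is not differentiable, the value of \<open>grad f\<close> is unspecified.\<close>

definition strongly_convex :: "real \<Rightarrow> ('a::euclidean_space \<Rightarrow> real) \<Rightarrow> bool" where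
  "strongly_convex \<mu> f \<longleftrightarrow>
     (\<forall>x y. f y - f x \<ge> inner (grad f x) (y - x) + \<mu> / 2 * (norm (y - x))\<^sup>2)"

definition smooth_with :: "real \<Rightarrow> ('a::euclidean_space \<Rightarrow> real) \<Rightarrow> bool" where
  "smooth_with L f \<longleftrightarrow> (\<forall>x y. norm (grad f x - grad f y) \<le> L * norm (x - y))"

text \<open>The value at step 0 of the Lyapunov function of the scheme, with \<open>xs\<close> the minimizer
  of \<open>f\<close>, \<open>x0\<close> and \<open>v0\<close> the initial data and \<open>x1\<close> the first iterate.\<close>

definition initial_energy ::
  "('a::euclidean_space \<Rightarrow> real) \<Rightarrow> real \<Rightarrow> real \<Rightarrow> real \<Rightarrow> real \<Rightarrow> 'a \<Rightarrow> 'a \<Rightarrow> 'a \<Rightarrow> 'a \<Rightarrow> real" where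
  "initial_energy f \<mu> s \<Delta>1 \<Delta>2 xs x0 x1 v0 =
     (1 + \<Delta>1) * (f x0 - f xs - \<Delta>2 * sqrt s / 2 * (norm (grad f x0))\<^sup>2)
     + 1 / 2 * (norm (v0 + sqrt \<mu> *\<^sub>R (x1 - xs) + \<Delta>2 *\<^sub>R grad f x0))\<^sup>2"

end

theory Submission
  imports Defs
begin

text \<open>The proof is a Lyapunov argument.  Write \<open>h = sqrt s\<close>, \<open>m = sqrt \<mu>\<close>, \<open>q = h * m\<close>,
  \<open>a = 1 + \<Delta>1\<close> and \<open>\<rho> = q / (1 + q)\<close>, and let \<open>E k\<close> be the initial energy formed from
  \<open>x k\<close>, \<open>x (k + 1)\<close> and \<open>v k\<close>.  The claim is that each step contracts the energy:
  \<open>(1 + \<rho>) * E (k + 1) \<le> E k\<close>.  Its kinetic part is half the square of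
  \<open>w k = v k + m (x (k + 1) - xs) + \<Delta>2 \<nabla>f (x k)\<close>, and the scheme is designed so that
  the gradient differences cancel in \<open>w (k + 1) - w k = - q v (k + 1) - a h \<nabla>f (x (k + 1))\<close>.
  Consequently \<open>E k - (1 + \<rho>) * E (k + 1)\<close>, once the old velocity is expressed by the new one,
  is the sum of a non-negative multiple of \<open>|v (k + 1)|\<^sup>2\<close> and of terms that are non-negative by

  \<^item> the interpolation inequality
    \<open>f x \<ge> f y + \<langle>\<nabla>f y, x - y\<rangle> + |\<nabla>f x - \<nabla>f y|\<^sup>2 / (2 L)\<close> for smooth convex functions
    (lemma \<open>smooth_convex_lower_bound\<close>), between consecutive iterates and between the
    iterate and the minimizer, together with its symmetrized form, cocoercivity;
  \<^item> strong convexity between the iterate and the minimizer;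
  \<^item> the three parameter conditions.

  The splitting is the identity in the proof of \<open>energy_step\<close>.  Discarding the kinetic part of
  the energy gives the first estimate, and \<open>|\<nabla>f x|\<^sup>2 \<le> 2 L (f x - f xs)\<close> turns it into the
  second one.\<close>

section \<open>Smooth convex functions\<close>

text \<open>Along the segment from \<open>x\<close> to \<open>y\<close>, the difference of the two sides is monotone in the
  parameter, because the Lipschitz bound controls the derivative.\<close>

lemma smooth_upper_bound:
  fixes f :: "'a::euclidean_space \<Rightarrow> real"
  assumes diff: "\<And>z. f differentiable at z" and smooth: "smooth_with L f"
  shows "f y \<le> f x + inner (grad f x) (y - x) + L / 2 * (norm (y - x))\<^sup>2"
proof -
  define u where "u = y - x"
  define \<phi> where
    "\<phi> t = f (x + t *\<^sub>R u) - t * inner (grad f x) u - L / 2 * t\<^sup>2 * (norm u)\<^sup>2" for t :: real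
  have "\<phi> 1 \<le> \<phi> 0"
  proof (rule DERIV_nonpos_imp_nonincreasing[where f = \<phi> and a = 0 and b = 1])
    fix t :: real assume t: "0 \<le> t" "t \<le> 1"
    have f': "(f has_derivative (\<lambda>h. inner h (grad f (x + t *\<^sub>R u)))) (at (x + t *\<^sub>R u))"
      using GDERIV_grad[OF diff] unfolding gderiv_def .
    have "((\<lambda>t. f (x + t *\<^sub>R u)) has_derivative
        (\<lambda>d. inner (d *\<^sub>R u) (grad f (x + t *\<^sub>R u)))) (at t)"
      by (rule has_derivative_compose[where f = "\<lambda>t. x + t *\<^sub>R u", OF _ f'])
        (auto intro!: derivative_eq_intros)
    then have "((\<lambda>t. f (x + t *\<^sub>R u)) has_real_derivative inner u (grad f (x + t *\<^sub>R u))) (at t)"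
      unfolding has_field_derivative_def
      by (simp add: mult.commute[of _ "inner _ _"] mult_commute_abs)
    then have D: "(\<phi> has_real_derivative
        (inner u (grad f (x + t *\<^sub>R u)) - inner (grad f x) u - L * t * (norm u)\<^sup>2)) (at t)"
      unfolding \<phi>_def by (auto intro!: derivative_eq_intros)
    have "inner u (grad f (x + t *\<^sub>R u)) - inner (grad f x) u
        = inner u (grad f (x + t *\<^sub>R u) - grad f x)"
      by (simp add: inner_diff_right inner_commute)
    also have "\<dots> \<le> norm u * norm (grad f (x + t *\<^sub>R u) - grad f x)"
      by (rule norm_cauchy_schwarz)
    also have "\<dots> \<le> norm u * (L * norm (x + t *\<^sub>R u - x))"
      by (intro mult_left_mono smooth[unfolded smooth_with_def, rule_format]) simp
    also have "\<dots> = L * t * (norm u)\<^sup>2"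
      using t by (simp add: power2_eq_square)
    finally have "inner u (grad f (x + t *\<^sub>R u)) - inner (grad f x) u
        - L * t * (norm u)\<^sup>2 \<le> 0"
      by simp
    with D show "\<exists>d. (\<phi> has_real_derivative d) (at t) \<and> d \<le> 0"
      by blast
  qed simp
  then show ?thesis
    by (simp add: \<phi>_def u_def)
qed

text \<open>The function \<open>z \<mapsto> f z - \<langle>\<nabla>f y, z\<rangle>\<close> is minimal at \<open>y\<close>; compare its minimum with its
  value after one gradient step of length \<open>1 / L\<close> from \<open>x\<close>.\<close>

lemma smooth_convex_lower_bound:
  fixes f :: "'a::euclidean_space \<Rightarrow> real"
  assumes diff: "\<And>z. f differentiable at z" and smooth: "smooth_with L f" and L: "L > 0"
    and convex: "\<And>x y. f y \<ge> f x + inner (grad f x) (y - x)"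
  shows "f x \<ge> f y + inner (grad f y) (x - y) + (norm (grad f x - grad f y))\<^sup>2 / (2 * L)"
proof -
  define u where "u = grad f x - grad f y"
  define z where "z = x - (1 / L) *\<^sub>R u"
  have up: "f z \<le> f x - inner (grad f x) u / L + (norm u)\<^sup>2 / (2 * L)"
    using smooth_upper_bound[OF diff smooth, of z x] L
    by (simp add: z_def power2_eq_square field_simps)
  have "f z \<ge> f y + inner (grad f y) (z - y)"
    by (rule convex)
  moreover have "inner (grad f y) (z - y) = inner (grad f y) (x - y) - inner (grad f y) u / L"
    by (simp add: z_def inner_diff_right)
  moreover have "inner (grad f x) u / L - inner (grad f y) u / L = (norm u)\<^sup>2 / L"
    by (simp add: u_def power2_norm_eq_inner inner_diff_left diff_divide_distrib)
  ultimately show ?thesis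
    using up by (simp add: u_def[symmetric] field_simps)
qed

text \<open>A gradient step of length \<open>1 / L\<close> cannot fall below the minimum.  At the minimizer itself
  the bound says that the gradient vanishes.\<close>

lemma smooth_gradient_bound:
  fixes f :: "'a::euclidean_space \<Rightarrow> real"
  assumes diff: "\<And>z. f differentiable at z" and smooth: "smooth_with L f" and L: "L > 0"
    and min: "\<And>z. f xs \<le> f z"
  shows "(norm (grad f x))\<^sup>2 \<le> 2 * L * (f x - f xs)"
proof -
  have "f xs \<le> f (x - (1 / L) *\<^sub>R grad f x)"
    by (rule min)
  also have "\<dots> \<le> f x - (norm (grad f x))\<^sup>2 / (2 * L)"
    using smooth_upper_bound[OF diff smooth, of "x - (1 / L) *\<^sub>R grad f x" x] L
    by (simp add: power2_norm_eq_inner[symmetric] power2_eq_square field_simps)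
  finally show ?thesis
    using L by (simp add: field_simps)
qed

section \<open>Contraction of the energy\<close>

lemma norm_sq_lincomb3:
  fixes u v w :: "'a::real_inner"
  shows "(norm (a *\<^sub>R u + b *\<^sub>R v + c *\<^sub>R w))\<^sup>2
    = a\<^sup>2 * inner u u + b\<^sup>2 * inner v v + c\<^sup>2 * inner w w
      + 2 * a * b * inner u v + 2 * a * c * inner u w + 2 * b * c * inner v w"
  unfolding power2_norm_eq_inner
  by (simp add: inner_add_left inner_add_right inner_commute power2_eq_square algebra_simps)

text \<open>The state moves from \<open>(x0, v0)\<close> to \<open>(y, v)\<close>.  The scheme is implicit in the velocity, so
  its rule is solved for \<open>v0\<close>: then, besides function values, the energy balance involves only inner products of \<open>v\<close>, the
  displacement \<open>d\<close> from the minimizer and the two gradients, and naming these makes it a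
  polynomial identity that exhibits the difference as a sum of non-negative terms.\<close>

lemma energy_step:
  fixes f :: "'a::euclidean_space \<Rightarrow> real" and \<mu> s :: real
  defines "q \<equiv> sqrt (\<mu> * s)"
  defines "\<rho> \<equiv> q / (1 + q)"
  assumes diff: "\<And>z. f differentiable at z"
    and sconv: "strongly_convex \<mu> f" and smooth: "smooth_with L f"
    and \<mu>: "\<mu> > 0" and L: "L > 0" and s: "s > 0"
    and min: "\<And>z. f xs \<le> f z"
    and \<Delta>1: "\<Delta>1 \<ge> 0"
    and cond1: "\<Delta>2 * sqrt s \<le> 1 / L"
    and cond2: "\<Delta>2 \<le> sqrt s * (1 + \<Delta>1)"
    and cond3: "\<rho> * \<Delta>2\<^sup>2 - \<Delta>2 * sqrt s * (1 + \<Delta>1) * (\<rho> + 2) + (1 + \<Delta>1)\<^sup>2 * s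
         - \<rho> * (\<Delta>1 / L) + 2 * \<mu> * sqrt s / ((1 + q) * L) * (\<Delta>2 - sqrt s * (1 + \<Delta>1)) \<le> 0"
    and y: "y = x0 + sqrt s *\<^sub>R v0" and z: "z = y + sqrt s *\<^sub>R v"
    and v0: "v0 = (1 + 2 * q) *\<^sub>R v + (sqrt s * (1 + \<Delta>1)) *\<^sub>R grad f y
                   + \<Delta>2 *\<^sub>R (grad f y - grad f x0)"
  shows "(1 + \<rho>) * initial_energy f \<mu> s \<Delta>1 \<Delta>2 xs y z v
           \<le> initial_energy f \<mu> s \<Delta>1 \<Delta>2 xs x0 y v0"
proof -
  define h m a l where "h = sqrt s" and "m = sqrt \<mu>" and "a = 1 + \<Delta>1" and "l = 1 / L"
  define g g0 d where "g = grad f y" and "g0 = grad f x0" and "d = y - xs"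
  define F F0 where "F = f y - f xs" and "F0 = f x0 - f xs"
  define V D G G0 where "V = inner v v" and "D = inner d d" and "G = inner g g"
    and "G0 = inner g0 g0"
  define vd vg gd gg where "vd = inner v d" and "vg = inner v g" and "gd = inner g d"
    and "gg = inner g g0"
  define N where "N = (norm (g - g0))\<^sup>2"
  define E0 E1 where "E0 = initial_energy f \<mu> s \<Delta>1 \<Delta>2 xs x0 y v0"
    and "E1 = initial_energy f \<mu> s \<Delta>1 \<Delta>2 xs y z v"
  have pos: "h > 0" "m > 0" "l > 0" "q > 0" "\<rho> > 0" "a > 0"
    using \<mu> s L \<Delta>1 by (auto simp: h_def m_def l_def q_def \<rho>_def a_def add_pos_pos)
  have hm: "q = h * m" "s = h\<^sup>2" "\<mu> = m\<^sup>2"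
    using \<mu> s by (simp_all add: q_def h_def m_def real_sqrt_mult)
  have \<rho>q: "\<rho> + \<rho> * q = q"
  proof -
    have "\<rho> * (1 + q) = q"
      using pos(4) by (simp add: \<rho>_def)
    then show ?thesis
      by (simp add: distrib_left)
  qed
  have convex: "f y \<ge> f x + inner (grad f x) (y - x)" for x y
  proof -
    have "f y - f x \<ge> inner (grad f x) (y - x) + \<mu> / 2 * (norm (y - x))\<^sup>2"
      using sconv by (simp add: strongly_convex_def)
    moreover have "\<mu> / 2 * (norm (y - x))\<^sup>2 \<ge> 0"
      using \<mu> by simp
    ultimately show ?thesis by linarith
  qed
  have gxs: "grad f xs = 0"
    using smooth_gradient_bound[OF diff smooth L min, of xs] by simp
  note lower = smooth_convex_lower_bound[OF diff smooth L convex]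
  have N: "N = G - 2 * gg + G0"
    by (simp add: N_def G_def gg_def G0_def power2_norm_eq_inner inner_diff_left
        inner_diff_right inner_commute)
  define S0 where "S0 = F0 - F + h * ((1 + 2 * q) * vg + a * h * G + \<Delta>2 * (G - gg)) - l / 2 * N"
  have S0: "S0 \<ge> 0"
  proof -
    have "x0 - y = - (h *\<^sub>R v0)"
      by (simp add: y h_def)
    moreover have "v0 = (1 + 2 * q) *\<^sub>R v + (a * h) *\<^sub>R g + \<Delta>2 *\<^sub>R (g - g0)"
      using v0 by (simp add: g_def g0_def a_def h_def mult.commute)
    ultimately have "inner g (x0 - y) = - h * ((1 + 2 * q) * vg + a * h * G + \<Delta>2 * (G - gg))"
      by (simp add: vg_def G_def gg_def inner_add_right inner_diff_right inner_commute)
    then show ?thesis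
      using lower[of y x0] by (simp add: S0_def N_def l_def F_def F0_def g_def g0_def
          norm_minus_commute)
  qed
  have S1: "gd - F - l / 2 * G \<ge> 0"
    using lower[of y xs] gxs
    by (simp add: gd_def F_def l_def G_def g_def d_def power2_norm_eq_inner inner_diff_right)
  have S2: "gd - F - \<mu> / 2 * D \<ge> 0"
    using sconv[unfolded strongly_convex_def, rule_format, of y xs]
    by (simp add: gd_def F_def D_def g_def d_def power2_norm_eq_inner[symmetric] inner_diff_right
        norm_minus_commute)
  have "F - l / 2 * G \<ge> 0"
    using lower[of xs y] gxs
    by (simp add: F_def l_def G_def g_def power2_norm_eq_inner)
  \<comment> \<open>Adding the two interpolation inequalities between \<open>y\<close> and \<open>xs\<close> gives cocoercivity.\<close>
  then have S3: "gd - l * G \<ge> 0"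
    using S1 by linarith
  have S4: "\<rho> * \<Delta>2\<^sup>2 - \<Delta>2 * h * a * (\<rho> + 2) + a\<^sup>2 * h\<^sup>2 - \<rho> * \<Delta>1 * l
      + 2 * m * \<rho> * l * (\<Delta>2 - h * a) \<le> 0"
  proof -
    have "2 * \<mu> * sqrt s / ((1 + q) * L) = 2 * m * \<rho> * l"
      using pos(1) by (simp add: \<rho>_def l_def hm power2_eq_square flip: h_def)
    then show ?thesis
      using cond3 pos(1) by (simp add: hm(2) a_def l_def flip: h_def)
  qed
  have S5: "l - \<Delta>2 * h \<ge> 0" and S6: "h * a - \<Delta>2 \<ge> 0"
    using cond1 cond2 by (simp_all add: h_def l_def a_def)
  have w1: "v + sqrt \<mu> *\<^sub>R (z - xs) + \<Delta>2 *\<^sub>R grad f y = (1 + q) *\<^sub>R v + m *\<^sub>R d + \<Delta>2 *\<^sub>R g"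
    by (simp add: z d_def g_def m_def[symmetric] h_def[symmetric] hm(1) algebra_simps)
  have w0: "v0 + sqrt \<mu> *\<^sub>R (y - xs) + \<Delta>2 *\<^sub>R grad f x0
      = (1 + 2 * q) *\<^sub>R v + m *\<^sub>R d + (\<Delta>2 + a * h) *\<^sub>R g"
    by (simp add: v0 d_def g_def m_def a_def h_def algebra_simps)
  have E1: "E1 = a * (F - \<Delta>2 * h / 2 * G)
      + 1 / 2 * ((1 + q)\<^sup>2 * V + m\<^sup>2 * D + \<Delta>2\<^sup>2 * G
        + 2 * (1 + q) * m * vd + 2 * (1 + q) * \<Delta>2 * vg + 2 * m * \<Delta>2 * gd)"
    unfolding E1_def initial_energy_def w1 norm_sq_lincomb3
    by (simp add: a_def F_def h_def V_def D_def G_def vd_def vg_def gd_def g_def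
        power2_norm_eq_inner inner_commute)
  have E0: "E0 = a * (F0 - \<Delta>2 * h / 2 * G0)
      + 1 / 2 * ((1 + 2 * q)\<^sup>2 * V + m\<^sup>2 * D + (\<Delta>2 + a * h)\<^sup>2 * G
        + 2 * (1 + 2 * q) * m * vd + 2 * (1 + 2 * q) * (\<Delta>2 + a * h) * vg
        + 2 * m * (\<Delta>2 + a * h) * gd)"
    unfolding E0_def initial_energy_def w0 norm_sq_lincomb3
    by (simp add: a_def F0_def h_def V_def D_def G_def G0_def g0_def vd_def vg_def gd_def
        power2_norm_eq_inner inner_commute)
  \<comment> \<open>The mixed terms in \<open>vd\<close> and \<open>vg\<close> cancel.  The weight \<open>1 + \<Delta>1\<close> of \<open>gd - F\<close> is
    split: the part \<open>1\<close> is used for strong convexity, which absorbs \<open>D\<close>, and the part \<open>\<Delta>1\<close>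
    for smoothness, which absorbs the term \<open>\<rho> * \<Delta>1 / L\<close> of the third parameter condition.\<close>
  have "E0 - (1 + \<rho>) * E1
      = a * S0 + a / 2 * (l - \<Delta>2 * h) * N + (q / 2 + q\<^sup>2) * V
        + G / 2 * - (\<rho> * \<Delta>2\<^sup>2 - \<Delta>2 * h * a * (\<rho> + 2) + a\<^sup>2 * h\<^sup>2 - \<rho> * \<Delta>1 * l
            + 2 * m * \<rho> * l * (\<Delta>2 - h * a))
        + \<rho> * (m * (h * a - \<Delta>2) * (gd - l * G)
            + (gd - F - \<mu> / 2 * D) + \<Delta>1 * (gd - F - l / 2 * G))"
    using \<rho>q hm(1) hm(3) a_def N unfolding E0 E1 S0_def by algebra
  also have "\<dots> \<ge> 0"
    using pos S0 S1 S2 S3 S4 S5 S6 \<Delta>1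
    by (intro add_nonneg_nonneg mult_nonneg_nonneg) (auto simp: N_def V_def G_def)
  finally show ?thesis
    by (simp add: E0_def E1_def)
qed

section \<open>Convergence rate\<close>

theorem theorem4:
  fixes f :: "'a::euclidean_space \<Rightarrow> real"
    and \<mu> L s \<Delta>1 \<Delta>2 :: real
    and xs :: 'a
    and x v :: "nat \<Rightarrow> 'a"
  assumes "continuously_differentiable f"
    and "strongly_convex \<mu> f"
    and "smooth_with L f"
    and "\<mu> > 0" and "L > 0"
    and "is_arg_min f (\<lambda>_. True) xs"
    and "\<Delta>1 \<ge> 0" and "\<Delta>2 \<ge> 0" and "s > 0"
    and "\<Delta>2 * sqrt s \<le> 1 / L"
    and "\<Delta>2 \<le> sqrt s * (1 + \<Delta>1)"
    and "sqrt (\<mu> * s) / (1 + sqrt (\<mu> * s)) * \<Delta>2\<^sup>2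
         - \<Delta>2 * sqrt s * (1 + \<Delta>1) * (sqrt (\<mu> * s) / (1 + sqrt (\<mu> * s)) + 2)
         + (1 + \<Delta>1)\<^sup>2 * s
         - sqrt (\<mu> * s) / (1 + sqrt (\<mu> * s)) * (\<Delta>1 / L)
         + 2 * \<mu> * sqrt s / ((1 + sqrt (\<mu> * s)) * L) * (\<Delta>2 - sqrt s * (1 + \<Delta>1)) \<le> 0"
    and "\<And>k. (x (Suc k) - x k) /\<^sub>R sqrt s = v k"
    and "\<And>k. (v (Suc k) - v k) /\<^sub>R sqrt s =
           - (2 * sqrt \<mu>) *\<^sub>R v (Suc k) - (1 + \<Delta>1) *\<^sub>R grad f (x (Suc k))
           - \<Delta>2 *\<^sub>R ((grad f (x (Suc k)) - grad f (x k)) /\<^sub>R sqrt s)"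
  shows "(\<forall>k. f (x k) - f xs - \<Delta>2 * sqrt s / 2 * (norm (grad f (x k)))\<^sup>2
              \<le> 1 / (1 + \<Delta>1) * (1 + sqrt (\<mu> * s) / (1 + sqrt (\<mu> * s))) powi (- int k)
                 * initial_energy f \<mu> s \<Delta>1 \<Delta>2 xs (x 0) (x 1) (v 0))
       \<and> (\<Delta>2 * sqrt s < 1 / L \<longrightarrow>
           (\<forall>k. f (x k) - f xs
                \<le> 1 / ((1 - L * \<Delta>2 * sqrt s) * (1 + \<Delta>1))
                   * (1 + sqrt (\<mu> * s) / (1 + sqrt (\<mu> * s))) powi (- int k)
                   * initial_energy f \<mu> s \<Delta>1 \<Delta>2 xs (x 0) (x 1) (v 0)))"
proof -
  define \<rho> where "\<rho> = sqrt (\<mu> * s) / (1 + sqrt (\<mu> * s))"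
  define E where "E k = initial_energy f \<mu> s \<Delta>1 \<Delta>2 xs (x k) (x (Suc k)) (v k)" for k
  have pos: "sqrt s > 0" "\<rho> \<ge> 0"
    using assms(4,9) by (auto simp: \<rho>_def)
  have diff: "f differentiable at z" for z
    using assms(1) by (simp add: continuously_differentiable_def)
  have min: "f xs \<le> f z" for z
    using assms(6) by (auto simp: is_arg_min_def not_less)
  have x_step: "x (Suc k) = x k + sqrt s *\<^sub>R v k" for k
    using pos by (simp add: assms(13)[symmetric])
  have v_step: "v k = (1 + 2 * sqrt (\<mu> * s)) *\<^sub>R v (Suc k)
      + (sqrt s * (1 + \<Delta>1)) *\<^sub>R grad f (x (Suc k))
      + \<Delta>2 *\<^sub>R (grad f (x (Suc k)) - grad f (x k))" for k
  proof -
    have "v (Suc k) - v k = sqrt s *\<^sub>R ((v (Suc k) - v k) /\<^sub>R sqrt s)"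
      using pos by simp
    also have "\<dots> = - (2 * sqrt (\<mu> * s)) *\<^sub>R v (Suc k)
        - (sqrt s * (1 + \<Delta>1)) *\<^sub>R grad f (x (Suc k))
        - \<Delta>2 *\<^sub>R (grad f (x (Suc k)) - grad f (x k))"
      unfolding assms(14) using pos by (simp add: real_sqrt_mult scaleR_diff_right mult_ac)
    finally show ?thesis
      by (simp add: algebra_simps)
  qed
  have step: "(1 + \<rho>) * E (Suc k) \<le> E k" for k
    unfolding E_def \<rho>_def
    by (rule energy_step[OF diff assms(2,3,4,5,9) min assms(7,10,11,12) x_step x_step v_step])
  have decay: "(1 + \<rho>) ^ k * E k \<le> E 0" for k
  proof (induction k)
    case (Suc k)
    have "(1 + \<rho>) ^ Suc k * E (Suc k) = (1 + \<rho>) ^ k * ((1 + \<rho>) * E (Suc k))"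
      by simp
    also have "\<dots> \<le> (1 + \<rho>) ^ k * E k"
      using pos step by (intro mult_left_mono) auto
    finally show ?case
      using Suc.IH by linarith
  qed simp
  have rate: "f (x k) - f xs - \<Delta>2 * sqrt s / 2 * (norm (grad f (x k)))\<^sup>2
      \<le> 1 / (1 + \<Delta>1) * (1 + \<rho>) powi (- int k) * E 0" for k
  proof -
    have "(1 + \<Delta>1) * (f (x k) - f xs - \<Delta>2 * sqrt s / 2 * (norm (grad f (x k)))\<^sup>2) \<le> E k"
      by (simp add: E_def initial_energy_def)
    also have "E k \<le> (1 + \<rho>) powi (- int k) * E 0"
      using decay[of k] pos by (simp add: power_int_minus field_simps)
    finally show ?thesis
      using assms(7) by (simp add: field_simps)
  qed
  have rate': "f (x k) - f xs
      \<le> 1 / ((1 - L * \<Delta>2 * sqrt s) * (1 + \<Delta>1)) * (1 + \<rho>) powi (- int k) * E 0"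
    if "\<Delta>2 * sqrt s < 1 / L" for k
  proof -
    have c: "1 - L * \<Delta>2 * sqrt s > 0"
      using that assms(5) by (simp add: field_simps)
    have "\<Delta>2 * sqrt s / 2 * (norm (grad f (x k)))\<^sup>2
        \<le> \<Delta>2 * sqrt s / 2 * (2 * L * (f (x k) - f xs))"
      using smooth_gradient_bound[OF diff assms(3,5) min] assms(8) pos
      by (intro mult_left_mono) auto
    then have "(1 - L * \<Delta>2 * sqrt s) * (f (x k) - f xs)
        \<le> f (x k) - f xs - \<Delta>2 * sqrt s / 2 * (norm (grad f (x k)))\<^sup>2"
      by (simp add: algebra_simps)
    also note rate
    finally have "f (x k) - f xs
        \<le> (1 / (1 + \<Delta>1) * (1 + \<rho>) powi (- int k) * E 0) / (1 - L * \<Delta>2 * sqrt s)"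
      unfolding pos_le_divide_eq[OF c] by (subst mult.commute)
    then show ?thesis
      by (simp add: mult.commute)
  qed
  show ?thesis
    using rate rate' by (simp add: \<rho>_def E_def)
qed

end
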